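(* Let $G=(V,E)$ be a connected graph of order $n\geq 3$. Let $U\subset V$ be a vertex subset with $m=|U|<n$, let $\overline{U}=V\setminus U$, let $G[U]=(U,E[U])$ and $G[\overline{U}]$ be the corresponding induced subgraphs, and let $q'_1$ be the largest signless Laplacian eigenvalue of $G[\overline{U}]$. Then $$\sum_{i=1}^{m+1} q_i(G)\geq\sum_{u\in U} d_u+m-|E[U]|+q'_1.$$
   Context: $Q(G)=D+A$ is the signless Laplacian of $G$ (degree diagonal matrix plus adjacency matrix), with eigenvalues $q_1(G)\geq\cdots\geq q_n(G)$; $d_u$ is the degree of $u$ in $G$; $E[U]$ is the set of edges of $G$ with both endpoints in $U$. *)

theory Defs
  imports "Jordan_Normal_Form.Char_Poly" "HOL-Computational_Algebra.Polynomial"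
begin

definition simple_graph :: "'a set \<Rightarrow> 'a set set \<Rightarrow> bool" where
  "simple_graph V E \<longleftrightarrow> finite V \<and> (\<forall>e\<in>E. e \<subseteq> V \<and> card e = 2)"

definition connected_graph :: "'a set \<Rightarrow> 'a set set \<Rightarrow> bool" where
  "connected_graph V E \<longleftrightarrow> V \<noteq> {} \<and> (\<forall>u\<in>V. \<forall>v\<in>V. (u, v) \<in> {(x, y). {x, y} \<in> E}\<^sup>*)"

definition vertex_degree :: "'a set set \<Rightarrow> 'a \<Rightarrow> nat" where
  "vertex_degree E v = card {e \<in> E. v \<in> e}"

definition edges_within :: "'a set set \<Rightarrow> 'a set \<Rightarrow> 'a set set" where
  "edges_within E U = {e \<in> E. e \<subseteq> U}"

text \<open>The library's matrices are indexed by initial segments of the naturals, so the rows and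
  columns are labelled through a fixed but arbitrary enumeration of the vertices. Another
  enumeration conjugates the matrix by a permutation and leaves the spectrum unchanged.\<close>

definition vertex_list :: "'a set \<Rightarrow> 'a list" where
  "vertex_list V = (SOME vs. set vs = V \<and> distinct vs)"

lemma vertex_list:
  assumes "finite V"
  shows "set (vertex_list V) = V" "distinct (vertex_list V)" "length (vertex_list V) = card V"
proof -
  have *: "set (vertex_list V) = V \<and> distinct (vertex_list V)"
    unfolding vertex_list_def by (rule someI_ex) (rule finite_distinct_list[OF assms])
  then show "set (vertex_list V) = V" "distinct (vertex_list V)" by simp_all
  with distinct_card show "length (vertex_list V) = card V" by metis
qed

definition degree_matrix :: "'a set \<Rightarrow> 'a set set \<Rightarrow> real mat" where
  "degree_matrix V E = mat (card V) (card V)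
     (\<lambda>(i, j). if i = j then real (vertex_degree E (vertex_list V ! i)) else 0)"

text \<open>In a simple graph the singleton \<open>{v, v}\<close> is not an edge, so the diagonal is zero.\<close>

definition adjacency_matrix :: "'a set \<Rightarrow> 'a set set \<Rightarrow> real mat" where
  "adjacency_matrix V E = mat (card V) (card V)
     (\<lambda>(i, j). if {vertex_list V ! i, vertex_list V ! j} \<in> E then 1 else 0)"

definition signless_laplacian :: "'a set \<Rightarrow> 'a set set \<Rightarrow> real mat" where
  "signless_laplacian V E = degree_matrix V E + adjacency_matrix V E"

text \<open>All real eigenvalues, repeated according to multiplicity, in decreasing order. A real
  symmetric matrix of dimension \<open>n\<close> has \<open>n\<close> of them.\<close>

definition eigenvalues_desc :: "real mat \<Rightarrow> real list" where
  "eigenvalues_desc A = rev (sorted_list_of_multiset (proots (char_poly A)))"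

text \<open>Numbered from 1: \<open>signless_eigenvalue V E 1\<close> is the largest eigenvalue. The value is
  meaningful only for indices between 1 and \<open>card V\<close>.\<close>

definition signless_eigenvalue :: "'a set \<Rightarrow> 'a set set \<Rightarrow> nat \<Rightarrow> real" where
  "signless_eigenvalue V E i = eigenvalues_desc (signless_laplacian V E) ! (i - 1)"

end

theory Submission
  imports Defs
begin

text \<open>Let \<open>N\<close> be the vertex-edge incidence matrix, so that the signless Laplacian is \<open>N N\<^sup>T\<close>. By a
  Ky Fan argument, the \<open>k\<close> largest eigenvalues sum to at least \<open>\<Sum>j. \<parallel>N y\<^sub>j\<parallel>\<^sup>2\<close> for any \<open>k\<close> pairwise
  orthogonal edge vectors \<open>y\<^sub>j\<close> of norm at most 1. Vectors with disjoint supports are orthogonal: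
  by connectedness, the edges meeting \<open>U\<close> split into nonempty stars \<open>S\<^sub>u\<close> centred at the vertices
  \<open>u\<close> of \<open>U\<close>, and the normalised indicator of \<open>S\<^sub>u\<close> contributes at least \<open>|S\<^sub>u| + 1\<close>. A top edge
  vector of the graph induced on \<open>V - U\<close> contributes its largest eigenvalue. The star sizes add up
  to the number of edges meeting \<open>U\<close>, which is \<open>\<Sum>u\<in>U. d\<^sub>u - |E[U]|\<close>.\<close>

section \<open>Spectral theorem for real symmetric matrices\<close>

text \<open>The fundamental theorem of algebra gives a complex eigenpair. Symmetry makes the
  eigenvalue real, so it is a root of the real characteristic polynomial and has a real eigenvector,
  which is then normalised.\<close>

lemma real_symmetric_eigenvector:
  fixes A :: "real mat"
  assumes A: "A \<in> carrier_mat n n" and sym: "transpose_mat A = A" and n: "n > 0"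
  obtains e v where "v \<in> carrier_vec n" "v \<bullet> v = 1" "A *\<^sub>v v = e \<cdot>\<^sub>v v"
proof -
  let ?C = "map_mat complex_of_real A"
  have C: "?C \<in> carrier_mat n n" using A by simp
  have "\<not> constant (poly (char_poly ?C))"
    using degree_monic_char_poly[OF C] n by (simp add: constant_degree)
  then obtain k where k: "poly (char_poly ?C) k = 0"
    using fundamental_theorem_of_algebra by blast
  then obtain z where "eigenvector ?C z k"
    using eigenvalue_root_char_poly[OF C] unfolding eigenvalue_def by blast
  then have z: "z \<in> carrier_vec n" "z \<noteq> 0\<^sub>v n" "?C *\<^sub>v z = k \<cdot>\<^sub>v z"
    using A unfolding eigenvector_def by auto
  have sA: "A $$ (i, j) = A $$ (j, i)" if "i < n" "j < n" for i j
    using arg_cong[OF sym, of "\<lambda>B. B $$ (i, j)"] that A by simp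
  have row: "(\<Sum>j<n. of_real (A $$ (i, j)) * z $ j) = k * z $ i" if "i < n" for i
  proof -
    have "(?C *\<^sub>v z) $ i = (k \<cdot>\<^sub>v z) $ i" using z by simp
    then show ?thesis using that A z(1)
      by (simp add: mult_mat_vec_def scalar_prod_def atLeast0LessThan)
  qed
  \<comment> \<open>\<open>S\<close> is the Hermitian form of \<open>A\<close> at \<open>z\<close>
    and \<open>N\<close> the squared norm of \<open>z\<close>. The eigenvalue is their quotient,
    hence real once \<open>S\<close> is shown to be real.\<close>
  define S where "S = (\<Sum>i<n. \<Sum>j<n. cnj (z $ i) * of_real (A $$ (i, j)) * z $ j)"
  define N where "N = (\<Sum>i<n. (cmod (z $ i))\<^sup>2)"
  have SN: "S = k * of_real N"
  proof -
    have "S = (\<Sum>i<n. cnj (z $ i) * (\<Sum>j<n. of_real (A $$ (i, j)) * z $ j))"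
      unfolding S_def by (simp add: sum_distrib_left mult.assoc)
    also have "\<dots> = (\<Sum>i<n. k * of_real ((cmod (z $ i))\<^sup>2))"
      by (intro sum.cong refl) (simp only: row lessThan_iff complex_norm_square, simp add: algebra_simps)
    finally show ?thesis by (simp add: N_def sum_distrib_left)
  qed
  have "cnj S = (\<Sum>i<n. \<Sum>j<n. cnj (z $ j) * of_real (A $$ (j, i)) * z $ i)"
    unfolding S_def by (simp add: sA algebra_simps)
  also have "\<dots> = S" unfolding S_def by (rule sum.swap)
  finally have cS: "cnj S = S" .
  have "N \<noteq> 0"
  proof
    assume "N = 0"
    then have "\<forall>i<n. z $ i = 0" unfolding N_def by (simp add: sum_nonneg_eq_0_iff)
    with z show False by (auto simp: vec_eq_iff)
  qed
  with cS SN have "cnj k = k" by simp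
  then obtain e where e: "k = of_real e" by (metis Reals_cases Reals_cnj_iff)
  have "poly (char_poly A) e = 0"
  proof -
    have "char_poly ?C = map_poly of_real (char_poly A)"
      by (rule of_real_hom.char_poly_hom[OF A])
    with k e have "of_real (poly (char_poly A) e) = (0 :: complex)" by simp
    then show ?thesis by simp
  qed
  then obtain w where "eigenvector A w e"
    using eigenvalue_root_char_poly[OF A] unfolding eigenvalue_def by blast
  then have w: "w \<in> carrier_vec n" "w \<noteq> 0\<^sub>v n" "A *\<^sub>v w = e \<cdot>\<^sub>v w"
    using A unfolding eigenvector_def by auto
  define r where "r = 1 / sqrt (w \<bullet> w)"
  have "w \<bullet> w = (\<Sum>i<n. (w $ i)\<^sup>2)"
    using w by (simp add: scalar_prod_def power2_eq_square atLeast0LessThan)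
  moreover have "(\<Sum>i<n. (w $ i)\<^sup>2) \<noteq> 0"
    using w by (auto simp: sum_nonneg_eq_0_iff vec_eq_iff)
  ultimately have "w \<bullet> w > 0" by (simp add: less_le sum_nonneg)
  then have "(r \<cdot>\<^sub>v w) \<bullet> (r \<cdot>\<^sub>v w) = 1"
    using w by (simp add: r_def)
  moreover have "A *\<^sub>v (r \<cdot>\<^sub>v w) = e \<cdot>\<^sub>v (r \<cdot>\<^sub>v w)"
    using w A by (simp add: mult_mat_vec smult_smult_assoc mult.commute)
  ultimately show thesis using that[of "r \<cdot>\<^sub>v w" e] w by simp
qed

text \<open>The reflection exchanging the two unit vectors; when they coincide, \<open>s = 0\<close> and the
  formula gives the identity because \<open>2 / 0 = 0\<close>.\<close>

lemma householder:
  fixes v :: "real vec"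
  assumes v: "v \<in> carrier_vec n" "v \<bullet> v = 1" and n: "n > 0"
  obtains H where "H \<in> carrier_mat n n" "transpose_mat H = H" "H * H = 1\<^sub>m n"
    "H *\<^sub>v unit_vec n 0 = v"
proof -
  define w where "w i = v $ i - (if i = 0 then 1 else 0)" for i
  define s where "s = (\<Sum>i<n. w i * w i)"
  define H where "H = mat n n (\<lambda>(i, j). (if i = j then 1 else 0) - 2 / s * w i * w j)"
  have H: "H \<in> carrier_mat n n" by (simp add: H_def)
  have sym: "transpose_mat H = H" by (rule eq_matI) (auto simp: H_def)
  have vv: "(\<Sum>i<n. v $ i * v $ i) = 1"
    using v by (simp add: scalar_prod_def atLeast0LessThan)
  have "s = (\<Sum>i<n. v $ i * v $ i + (if i = 0 then 1 - 2 * v $ 0 else 0))"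
    unfolding s_def w_def by (intro sum.cong) (auto simp: algebra_simps)
  also have "\<dots> = 2 - 2 * v $ 0" using n by (simp add: sum.distrib vv)
  finally have s: "s = 2 - 2 * v $ 0" .
  have s0: "w i = 0" if "s = 0" "i < n" for i
    using that unfolding s_def by (simp add: sum_nonneg_eq_0_iff)
  have inv: "H * H = 1\<^sub>m n"
  proof (rule eq_matI)
    fix i j assume ij: "i < dim_row (1\<^sub>m n)" "j < dim_col (1\<^sub>m n)"
    have "(H * H) $$ (i, j) = (\<Sum>l<n. ((if i = l then 1 else 0) - 2 / s * w i * w l)
        * ((if l = j then 1 else 0) - 2 / s * w l * w j))"
      using ij by (simp add: H_def scalar_prod_def atLeast0LessThan)
    also have "\<dots> = (\<Sum>l<n. (if l = i then (if i = j then 1 else 0) - 2 / s * w i * w j else 0)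
        - (if l = j then 2 / s * w i * w j else 0) + (2 / s)\<^sup>2 * w i * w j * (w l * w l))"
      by (intro sum.cong) (auto simp: algebra_simps power2_eq_square)
    also have "\<dots> = (if i = j then 1 else 0) - 4 / s * w i * w j + (2 / s)\<^sup>2 * w i * w j * s"
      using ij by (simp add: sum.distrib sum_subtractf flip: sum_distrib_left s_def)
    also have "\<dots> = (if i = j then 1 else 0)"
      by (cases "s = 0") (simp_all add: power2_eq_square)
    finally show "(H * H) $$ (i, j) = 1\<^sub>m n $$ (i, j)" using ij by simp
  qed (simp_all add: H_def)
  have "H *\<^sub>v unit_vec n 0 = v"
  proof (rule eq_vecI)
    fix i assume i: "i < dim_vec v"
    have "(H *\<^sub>v unit_vec n 0) $ i = H $$ (i, 0)"
      using i v n by (simp add: H_def)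
    also have "\<dots> = (if i = 0 then 1 else 0) - 2 / s * w i * w 0"
      using i v n by (simp add: H_def)
    also have "\<dots> = (if i = 0 then 1 else 0) + w i"
    proof (cases "s = 0")
      case True
      then show ?thesis using s0[of i] i v by simp
    next
      case False
      \<comment> \<open>Since \<open>w 0 = v $ 0 - 1\<close>, the formula for \<open>s\<close> says
        \<open>2 * w 0 = - s\<close>. Column 0 of \<open>H\<close> is thus the unit vector plus
        \<open>w\<close>, which is \<open>v\<close>.\<close>
      then have w0: "2 / s * w 0 = - 1" using s by (simp add: w_def field_simps)
      have "2 / s * w i * w 0 = w i * (2 / s * w 0)" by simp
      then show ?thesis unfolding w0 by simp
    qed
    finally show "(H *\<^sub>v unit_vec n 0) $ i = v $ i" by (simp add: w_def)
  qed (use v in \<open>simp add: H_def\<close>)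
  with H sym inv show thesis using that by blast
qed

text \<open>Deflation: conjugating by the reflection that carries the first unit vector to a unit
  eigenvector splits off a block of size 1, and the induction hypothesis diagonalizes the
  rest.\<close>

lemma real_symmetric_diagonalization:
  fixes A :: "real mat"
  assumes "A \<in> carrier_mat n n" and "transpose_mat A = A"
  shows "\<exists>P d. P \<in> carrier_mat n n \<and> transpose_mat P * P = 1\<^sub>m n
    \<and> A = P * mat_diag n d * transpose_mat P"
  using assms
proof (induction n arbitrary: A)
  case 0
  then show ?case by (intro exI[of _ "1\<^sub>m 0"] exI[of _ "\<lambda>_. 0"]) auto
next
  case (Suc n)
  note A = Suc.prems(1) and sym = Suc.prems(2)
  obtain e v where v: "v \<in> carrier_vec (Suc n)" "v \<bullet> v = 1" "A *\<^sub>v v = e \<cdot>\<^sub>v v"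
    using real_symmetric_eigenvector[OF A sym] by blast
  obtain H where H: "H \<in> carrier_mat (Suc n) (Suc n)" "transpose_mat H = H"
    "H * H = 1\<^sub>m (Suc n)" "H *\<^sub>v unit_vec (Suc n) 0 = v"
    using householder[OF v(1,2)] by blast
  define M where "M = H * A * H"
  define M' where "M' = mat n n (\<lambda>(i, j). M $$ (Suc i, Suc j))"
  have M: "M \<in> carrier_mat (Suc n) (Suc n)" using H A by (simp add: M_def)
  have HA: "H * A \<in> carrier_mat (Suc n) (Suc n)" using H A by simp
  have symM: "transpose_mat M = M"
    unfolding M_def transpose_mult[OF HA H(1)] transpose_mult[OF H(1) A] H(2) sym
    by (rule assoc_mult_mat[symmetric]) (use H A in auto)
  have Hv: "H *\<^sub>v v = unit_vec (Suc n) 0"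
    using assoc_mult_mat_vec[OF H(1) H(1), of "unit_vec (Suc n) 0"] H by simp
  have "M *\<^sub>v unit_vec (Suc n) 0 = H *\<^sub>v (A *\<^sub>v (H *\<^sub>v unit_vec (Suc n) 0))"
    unfolding M_def using H A by (simp add: assoc_mult_mat_vec[of _ "Suc n" "Suc n" _ "Suc n"])
  also have "\<dots> = e \<cdot>\<^sub>v unit_vec (Suc n) 0"
    using H v Hv by (simp add: mult_mat_vec)
  finally have col: "M *\<^sub>v unit_vec (Suc n) 0 = e \<cdot>\<^sub>v unit_vec (Suc n) 0" .
  have M0: "M $$ (i, 0) = (if i = 0 then e else 0)" if "i < Suc n" for i
    using arg_cong[OF col, of "\<lambda>x. x $ i"] that M by simp
  have Mc: "M $$ (i, j) = M $$ (j, i)" if "i < Suc n" "j < Suc n" for i j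
    using arg_cong[OF symM, of "\<lambda>B. B $$ (i, j)"] that M by simp
  \<comment> \<open>Column 0 of \<open>M\<close> is \<open>e\<close> times the first unit vector;
    symmetry gives the same for row 0.\<close>
  have blk: "M = four_block_mat (e \<cdot>\<^sub>m 1\<^sub>m 1) (0\<^sub>m 1 n) (0\<^sub>m n 1) M'"
    using M M0 Mc[of 0] by (intro eq_matI) (auto simp: M'_def)
  have M': "M' \<in> carrier_mat n n" by (simp add: M'_def)
  have "transpose_mat M' = M'" using Mc by (intro eq_matI) (auto simp: M'_def)
  from Suc.IH[OF M' this] obtain P' d where P': "P' \<in> carrier_mat n n"
    "transpose_mat P' * P' = 1\<^sub>m n" "M' = P' * mat_diag n d * transpose_mat P'" by blast
  \<comment> \<open>\<open>B\<close> extends the smaller orthogonal matrix by a fixed first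
    coordinate. Composing it with the reflection gives the required
    \<open>P = H * B\<close>.\<close>
  define B where "B = four_block_mat (1\<^sub>m 1) (0\<^sub>m 1 n) (0\<^sub>m n 1) P'"
  define D where "D = four_block_mat (e \<cdot>\<^sub>m 1\<^sub>m 1) (0\<^sub>m 1 n) (0\<^sub>m n 1) (mat_diag n d)"
  have D: "D = mat_diag (Suc n) (case_nat e d)"
    by (rule eq_matI) (auto simp: D_def mat_diag_def split: nat.splits)
  have B: "B \<in> carrier_mat (Suc n) (Suc n)"
    unfolding B_def using four_block_carrier_mat[OF one_carrier_mat[of 1] P'(1)] by simp
  have Dc: "D \<in> carrier_mat (Suc n) (Suc n)" by (simp add: D)
  have Bt: "transpose_mat B = four_block_mat (1\<^sub>m 1) (0\<^sub>m 1 n) (0\<^sub>m n 1) (transpose_mat P')"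
    unfolding B_def using P' by (subst transpose_four_block_mat) (auto simp: zero_transpose_mat)
  have BB: "transpose_mat B * B = 1\<^sub>m (Suc n)"
    unfolding Bt unfolding B_def using P'
    by (subst mult_four_block_mat[of _ 1 1 _ n _ n _ _ 1 _ n]) (auto intro!: eq_matI)
  have BDB: "B * D * transpose_mat B = M"
    unfolding Bt unfolding B_def D_def blk using P'
    by (auto simp: mult_four_block_mat[of _ 1 1 _ n _ n _ _ 1 _ n] left_mult_zero_mat[OF mat_diag_dim]
        right_mult_zero_mat[of _ n n] left_add_zero_mat[of _ n n])
  define P where "P = H * B"
  have P: "P \<in> carrier_mat (Suc n) (Suc n)" using H B by (simp add: P_def)
  have Pt: "transpose_mat P = transpose_mat B * H"
    unfolding P_def using H B by (simp add: transpose_mult[OF H(1) B])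
  have "transpose_mat P * P = transpose_mat B * (H * H) * B"
    unfolding Pt unfolding P_def using H(1) B by (simp add: assoc_mult_mat[of _ "Suc n" "Suc n" _ "Suc n" _ "Suc n"])
  also have "\<dots> = 1\<^sub>m (Suc n)" using H(3) B BB by simp
  finally have PP: "transpose_mat P * P = 1\<^sub>m (Suc n)" .
  have "P * D * transpose_mat P = H * (B * D * transpose_mat B) * H"
    unfolding Pt unfolding P_def using H(1) B Dc by (simp add: assoc_mult_mat[of _ "Suc n" "Suc n" _ "Suc n" _ "Suc n"])
  also have "\<dots> = (H * H) * A * (H * H)"
    unfolding BDB M_def using H(1) A by (simp add: assoc_mult_mat[of _ "Suc n" "Suc n" _ "Suc n" _ "Suc n"])
  also have "\<dots> = A" using H(3) A by simp
  finally show ?case using P PP unfolding D by metis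
qed

text \<open>Links the definition by roots to a diagonalization: similar matrices share their
  characteristic polynomial, and that of a diagonal matrix is a product of linear factors over the
  diagonal entries.\<close>

lemma eigenvalues_desc_diagonalized:
  fixes A :: "real mat"
  assumes P: "P \<in> carrier_mat n n" and PP: "transpose_mat P * P = 1\<^sub>m n"
    and A: "A = P * mat_diag n d * transpose_mat P"
  shows "mset (eigenvalues_desc A) = mset (map d [0..<n])"
proof -
  let ?D = "mat_diag n d"
  have PP': "P * transpose_mat P = 1\<^sub>m n"
    using mat_mult_left_right_inverse[of "transpose_mat P" n P] P PP by simp
  have "similar_mat A ?D"
    unfolding similar_mat_def
    by (intro exI, rule similar_mat_witI[OF PP' PP A]) (use P A in auto)
  then have "char_poly A = char_poly ?D" by (rule char_poly_similar)
  also have "\<dots> = (\<Prod>a\<leftarrow>diag_mat ?D. [:- a, 1:])"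
    by (rule char_poly_upper_triangular[of _ n]) (auto simp: mat_diag_def)
  also have "diag_mat ?D = map d [0..<n]"
    by (auto simp: diag_mat_def mat_diag_def)
  finally have cp: "char_poly A = (\<Prod>a\<leftarrow>map d [0..<n]. [:- a, 1:])" .
  have "proots (\<Prod>a\<leftarrow>ds. [:- a, 1:]) = mset ds" for ds :: "real list"
  proof (induction ds)
    case (Cons a ds)
    have "(\<Prod>a\<leftarrow>ds. [:- a, 1:]) \<noteq> 0" by (auto simp: prod_list_zero_iff)
    then show ?case using Cons by (simp add: proots_mult del: mult_pCons_left)
  qed simp
  then show ?thesis by (simp only: eigenvalues_desc_def cp mset_rev mset_sorted_list_of_multiset)
qed

lemma eigenvalues_desc_antimono:
  assumes "i \<le> j" "j < length (eigenvalues_desc A)"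
  shows "eigenvalues_desc A ! j \<le> eigenvalues_desc A ! i"
  using assms sorted_nth_mono[of "sorted_list_of_multiset (proots (char_poly A))"]
  by (auto simp: eigenvalues_desc_def rev_nth)

text \<open>The vectors are columns of the diagonalizing matrix. The first relation is
  orthonormality; the second is completeness, valid because a left inverse of a square matrix is
  also a right inverse. Completeness yields Parseval's identity later.\<close>

lemma real_symmetric_orthonormal_eigenbasis:
  fixes A :: "real mat"
  assumes A: "A \<in> carrier_mat n n" and sym: "transpose_mat A = A"
  obtains v :: "nat \<Rightarrow> nat \<Rightarrow> real" where
    "length (eigenvalues_desc A) = n"
    "\<And>i j. i < n \<Longrightarrow> j < n \<Longrightarrow> (\<Sum>r<n. v i r * v j r) = (if i = j then 1 else 0)"
    "\<And>r s. r < n \<Longrightarrow> s < n \<Longrightarrow> (\<Sum>i<n. v i r * v i s) = (if r = s then 1 else 0)"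
    "\<And>i r. i < n \<Longrightarrow> r < n \<Longrightarrow> (\<Sum>s<n. A $$ (r, s) * v i s) = eigenvalues_desc A ! i * v i r"
proof -
  obtain P d where P: "P \<in> carrier_mat n n" and PP: "transpose_mat P * P = 1\<^sub>m n"
    and AP: "A = P * mat_diag n d * transpose_mat P"
    using real_symmetric_diagonalization[OF A sym] by blast
  have PP': "P * transpose_mat P = 1\<^sub>m n"
    using mat_mult_left_right_inverse[of "transpose_mat P" n P] P PP by simp
  note ms = eigenvalues_desc_diagonalized[OF P PP AP]
  then have len: "length (eigenvalues_desc A) = n"
    using mset_eq_length by fastforce
  \<comment> \<open>The diagonal entries come in no particular order; \<open>p\<close> sorts them,
    and the columns of \<open>P\<close> are taken in the order given by \<open>p\<close>.\<close>
  obtain p where p: "p permutes {..<n}" "permute_list p (map d [0..<n]) = eigenvalues_desc A"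
    using mset_eq_permutation[OF ms] by auto
  have pn: "p i < n" if "i < n" for i using permutes_in_image[OF p(1)] that by simp
  have nth: "eigenvalues_desc A ! i = d (p i)" if "i < n" for i
    unfolding p(2)[symmetric] using that p(1) pn by (simp add: permute_list_nth)
  have orth: "(\<Sum>r<n. P $$ (r, i) * P $$ (r, j)) = (if i = j then 1 else 0)" if "i < n" "j < n" for i j
    using arg_cong[OF PP, of "\<lambda>B. B $$ (i, j)"] that P
    by (simp add: scalar_prod_def atLeast0LessThan)
  have orth': "(\<Sum>i<n. P $$ (r, i) * P $$ (s, i)) = (if r = s then 1 else 0)" if "r < n" "s < n" for r s
    using arg_cong[OF PP', of "\<lambda>B. B $$ (r, s)"] that P
    by (simp add: scalar_prod_def atLeast0LessThan)
  have "A * P = P * mat_diag n d"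
  proof -
    have "A * P = P * mat_diag n d * (transpose_mat P * P)"
      unfolding AP by (rule assoc_mult_mat[of _ n n]) (use P in simp_all)
    also have "\<dots> = P * mat_diag n d"
      unfolding PP using P by (intro right_mult_one_mat[of _ n]) auto
    finally show ?thesis .
  qed
  then have AP': "A * P = mat n n (\<lambda>(i, j). P $$ (i, j) * d j)"
    using mat_diag_mult_right[OF P] by simp
  have ev: "(\<Sum>s<n. A $$ (r, s) * P $$ (s, i)) = P $$ (r, i) * d i" if "i < n" "r < n" for i r
  proof -
    have "(\<Sum>s<n. A $$ (r, s) * P $$ (s, i)) = (A * P) $$ (r, i)"
      using that P A by (simp add: scalar_prod_def atLeast0LessThan)
    also have "\<dots> = P $$ (r, i) * d i" using that unfolding AP' by simp
    finally show ?thesis .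
  qed
  show thesis
  proof (rule that[of "\<lambda>i r. P $$ (r, p i)"])
    fix i j assume "i < n" "j < n"
    then show "(\<Sum>r<n. P $$ (r, p i) * P $$ (r, p j)) = (if i = j then 1 else 0)"
      using orth pn permutes_inj[OF p(1)] by (simp add: inj_eq)
  next
    fix r s assume "r < n" "s < n"
    then show "(\<Sum>i<n. P $$ (r, p i) * P $$ (s, p i)) = (if r = s then 1 else 0)"
      using orth' sum.permute[OF p(1), of "\<lambda>i. P $$ (r, i) * P $$ (s, i)"] by (simp add: o_def)
  qed (use len nth ev pn in \<open>simp_all add: mult.commute\<close>)
qed

section \<open>Bessel's inequality and weighted sums\<close>

lemma orthogonal_sum_power2:
  fixes u :: "'i \<Rightarrow> 'e \<Rightarrow> real"
  assumes I: "finite I"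
    and orth: "\<And>i j. i \<in> I \<Longrightarrow> j \<in> I \<Longrightarrow> i \<noteq> j \<Longrightarrow> (\<Sum>e\<in>E. u i e * u j e) = 0"
  shows "(\<Sum>e\<in>E. (\<Sum>i\<in>I. c i * u i e)\<^sup>2) = (\<Sum>i\<in>I. (c i)\<^sup>2 * (\<Sum>e\<in>E. (u i e)\<^sup>2))"
proof -
  have "(\<Sum>e\<in>E. (\<Sum>i\<in>I. c i * u i e)\<^sup>2)
      = (\<Sum>e\<in>E. \<Sum>i\<in>I. \<Sum>j\<in>I. c i * c j * (u i e * u j e))"
    by (simp add: power2_eq_square sum_product algebra_simps)
  also have "\<dots> = (\<Sum>i\<in>I. \<Sum>j\<in>I. \<Sum>e\<in>E. c i * c j * (u i e * u j e))"
    by (subst sum.swap, intro sum.cong refl, rule sum.swap)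
  also have "\<dots> = (\<Sum>i\<in>I. \<Sum>j\<in>I. c i * c j * (\<Sum>e\<in>E. u i e * u j e))"
    by (simp add: sum_distrib_left)
  also have "\<dots> = (\<Sum>i\<in>I. \<Sum>j\<in>I. if i = j then (c i)\<^sup>2 * (\<Sum>e\<in>E. (u i e)\<^sup>2) else 0)"
    using orth by (intro sum.cong refl) (auto simp: power2_eq_square)
  finally show ?thesis using I by simp
qed

text \<open>Zero vectors in the family are harmless: their terms are \<open>0 / 0 = 0\<close>.\<close>

lemma bessel_inequality:
  fixes u :: "'i \<Rightarrow> 'e \<Rightarrow> real"
  assumes I: "finite I"
    and orth: "\<And>i j. i \<in> I \<Longrightarrow> j \<in> I \<Longrightarrow> i \<noteq> j \<Longrightarrow> (\<Sum>e\<in>E. u i e * u j e) = 0"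
  shows "(\<Sum>i\<in>I. (\<Sum>e\<in>E. u i e * y e)\<^sup>2 / (\<Sum>e\<in>E. (u i e)\<^sup>2)) \<le> (\<Sum>e\<in>E. (y e)\<^sup>2)"
proof -
  define N where "N i = (\<Sum>e\<in>E. (u i e)\<^sup>2)" for i
  define s where "s i = (\<Sum>e\<in>E. u i e * y e)" for i
  define T where "T = (\<Sum>i\<in>I. (s i)\<^sup>2 / N i)"
  \<comment> \<open>\<open>p\<close> is the orthogonal projection of \<open>y\<close> onto the span
    of the family. Both its inner product with \<open>y\<close> and its squared norm equal
    \<open>T\<close>, so the squared distance from \<open>y\<close> to \<open>p\<close> is the
    difference of the two sides.\<close>
  define p where "p e = (\<Sum>i\<in>I. s i / N i * u i e)" for e
  have "(\<Sum>e\<in>E. y e * p e) = (\<Sum>e\<in>E. \<Sum>i\<in>I. s i / N i * (u i e * y e))"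
    by (simp add: p_def sum_distrib_left algebra_simps)
  also have "\<dots> = (\<Sum>i\<in>I. \<Sum>e\<in>E. s i / N i * (u i e * y e))"
    by (rule sum.swap)
  also have "\<dots> = (\<Sum>i\<in>I. s i / N i * s i)" by (simp only: s_def sum_distrib_left)
  also have "\<dots> = T" by (simp add: T_def power2_eq_square)
  finally have yp: "(\<Sum>e\<in>E. y e * p e) = T" .
  have "(\<Sum>e\<in>E. (p e)\<^sup>2) = (\<Sum>i\<in>I. (s i / N i)\<^sup>2 * N i)"
    unfolding N_def p_def by (rule orthogonal_sum_power2[OF I orth])
  also have "\<dots> = T"
    unfolding T_def by (intro sum.cong refl) (simp add: power2_eq_square)
  finally have pp: "(\<Sum>e\<in>E. (p e)\<^sup>2) = T" .
  have "0 \<le> (\<Sum>e\<in>E. (y e - p e)\<^sup>2)" by (rule sum_nonneg) simp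
  also have "\<dots> = (\<Sum>e\<in>E. (y e)\<^sup>2) - T"
    by (simp add: power2_diff sum.distrib sum_subtractf pp yp mult.assoc flip: sum_distrib_left)
  finally show ?thesis by (simp add: T_def s_def N_def)
qed

text \<open>With total weight at most \<open>k\<close> and each weight at most 1, it is best to put
  weight 1 on the \<open>k\<close> largest values. The proof subtracts the threshold
  \<open>q (k - 1)\<close> and compares term by term: the differences are nonnegative before index
  \<open>k\<close> and nonpositive from there on. Nonnegativity of the threshold allows the total
  weight to fall short of \<open>k\<close>.\<close>

lemma sum_weighted_le_sum_initial:
  fixes q c :: "nat \<Rightarrow> real"
  assumes q: "\<And>i j. i \<le> j \<Longrightarrow> j < n \<Longrightarrow> q j \<le> q i" "\<And>i. i < n \<Longrightarrow> 0 \<le> q i"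
    and c: "\<And>i. i < n \<Longrightarrow> 0 \<le> c i" "\<And>i. i < n \<Longrightarrow> c i \<le> 1" "(\<Sum>i<n. c i) \<le> real k"
    and k: "k \<le> n"
  shows "(\<Sum>i<n. q i * c i) \<le> (\<Sum>i<k. q i)"
proof (cases "k = 0")
  case True
  then have "(\<Sum>i<n. c i) = 0" using c by (intro antisym sum_nonneg) auto
  then have "\<forall>i<n. c i = 0" using c sum_nonneg_eq_0_iff[of "{..<n}" c] by auto
  with True show ?thesis by simp
next
  case False
  define t where "t = q (k - 1)"
  have t: "0 \<le> t" using q False k by (simp add: t_def)
  have "(\<Sum>i<n. q i * c i) = (\<Sum>i<n. (q i - t) * c i) + t * (\<Sum>i<n. c i)"
    by (simp add: algebra_simps sum.distrib sum_subtractf sum_distrib_left)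
  also have "\<dots> \<le> (\<Sum>i<n. if i < k then q i - t else 0) + t * real k"
  proof (intro add_mono sum_mono mult_left_mono)
    fix i assume i: "i \<in> {..<n}"
    show "(q i - t) * c i \<le> (if i < k then q i - t else 0)"
    proof (cases "i < k")
      case True
      then have "t \<le> q i" using q(1)[of i "k - 1"] k by (simp add: t_def)
      then show ?thesis using True c i by (simp add: mult_left_le)
    next
      case False
      then have "q i \<le> t" using q(1)[of "k - 1" i] i by (simp add: t_def)
      then show ?thesis using False c i by (simp add: mult_nonpos_nonneg)
    qed
  qed (use t c in auto)
  also have "(\<Sum>i<n. if i < k then q i - t else 0) = (\<Sum>i<k. q i - t)"
    using k by (intro sum.mono_neutral_cong_right) auto
  finally show ?thesis by (simp add: sum_subtractf)
qed

section \<open>Incidence sums and stars\<close>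

lemma simple_graph_finite:
  assumes "simple_graph V E"
  shows "finite V" "finite E" "\<And>e. e \<in> E \<Longrightarrow> finite e"
proof -
  show "finite V" using assms by (simp add: simple_graph_def)
  moreover have "E \<subseteq> Pow V" using assms by (auto simp: simple_graph_def)
  ultimately show "finite E" "\<And>e. e \<in> E \<Longrightarrow> finite e"
    by (auto intro: finite_subset)
qed

lemma simple_graph_edges_within:
  assumes "simple_graph V E" "W \<subseteq> V"
  shows "simple_graph W (edges_within E W)"
  using assms finite_subset by (auto simp: simple_graph_def edges_within_def)

text \<open>Summing over the endpoints of an edge and summing over the edges at a vertex are adjoint
  maps: this is double counting of incident pairs.\<close>

lemma incidence_adjoint:
  fixes f :: "'a \<Rightarrow> real"
  assumes "simple_graph V E"
  shows "(\<Sum>e\<in>E. (\<Sum>x\<in>e. f x) * y e) = (\<Sum>x\<in>V. f x * (\<Sum>e | e \<in> E \<and> x \<in> e. y e))"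
proof -
  note fin = simple_graph_finite[OF assms]
  have "(\<Sum>e\<in>E. (\<Sum>x\<in>e. f x) * y e) = (\<Sum>e\<in>E. \<Sum>x | x \<in> V \<and> x \<in> e. f x * y e)"
    using assms by (intro sum.cong refl)
      (auto simp: sum_distrib_right simple_graph_def intro!: sum.cong)
  also have "\<dots> = (\<Sum>x\<in>V. \<Sum>e | e \<in> E \<and> x \<in> e. f x * y e)"
    by (rule sum.swap_restrict[OF fin(2,1)])
  finally show ?thesis by (simp add: sum_distrib_left)
qed

text \<open>The product of the incidence matrix with its transpose, read at the vertex
  \<open>x\<close>: every edge at \<open>x\<close> contributes \<open>f x\<close> once, which gives
  the degree term, and the value of \<open>f\<close> at its other end.\<close>

lemma incidence_gram_eq_signless:
  fixes f :: "'a \<Rightarrow> real"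
  assumes G: "simple_graph V E" and x: "x \<in> V"
  shows "(\<Sum>e | e \<in> E \<and> x \<in> e. \<Sum>y\<in>e. f y)
    = real (vertex_degree E x) * f x + (\<Sum>y\<in>V. if {x, y} \<in> E then f y else 0)"
proof -
  define N where "N = {y \<in> V. {x, y} \<in> E}"
  have "finite N" using simple_graph_finite[OF G] by (simp add: N_def)
  have xN: "x \<notin> N" using G by (force simp: N_def simple_graph_def)
  have inj: "inj_on (\<lambda>y. {x, y}) N" by (auto simp: inj_on_def doubleton_eq_iff)
  have eq: "{e \<in> E. x \<in> e} = (\<lambda>y. {x, y}) ` N"
  proof (intro equalityI subsetI)
    fix e assume e: "e \<in> {e \<in> E. x \<in> e}"
    then have "card e = 2" "e \<subseteq> V" using G by (auto simp: simple_graph_def)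
    then obtain a b where "e = {a, b}" by (auto simp: card_2_iff)
    with e \<open>e \<subseteq> V\<close> show "e \<in> (\<lambda>y. {x, y}) ` N"
      by (auto simp: N_def insert_commute)
  qed (auto simp: N_def)
  have "(\<Sum>e | e \<in> E \<and> x \<in> e. \<Sum>y\<in>e. f y) = (\<Sum>z\<in>N. \<Sum>y\<in>{x, z}. f y)"
    unfolding eq by (simp add: sum.reindex[OF inj])
  also have "\<dots> = (\<Sum>z\<in>N. f x + f z)"
  proof (intro sum.cong refl)
    fix z assume "z \<in> N"
    with xN have "x \<noteq> z" by blast
    then show "(\<Sum>y\<in>{x, z}. f y) = f x + f z" by simp
  qed
  also have "\<dots> = real (card N) * f x + (\<Sum>z\<in>N. f z)"
    by (simp add: sum.distrib)
  also have "card N = vertex_degree E x"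
    unfolding vertex_degree_def eq by (simp add: card_image[OF inj])
  also have "(\<Sum>z\<in>N. f z) = (\<Sum>y\<in>V. if {x, y} \<in> E then f y else 0)"
    unfolding N_def using simple_graph_finite[OF G] by (simp add: sum.inter_filter)
  finally show ?thesis .
qed

text \<open>The centre \<open>u\<close> lies on all edges of \<open>S\<close> and contributes the
  square. Of the \<open>2 * card S\<close> incidences, \<open>card S\<close> remain for the other
  vertices, and a natural number is at most its square.\<close>

lemma star_incidence:
  assumes G: "simple_graph V E" and u: "u \<in> V" and S: "S \<subseteq> {e \<in> E. u \<in> e}"
  shows "(card S)\<^sup>2 + card S \<le> (\<Sum>x\<in>V. (card {e \<in> S. x \<in> e})\<^sup>2)"
proof -
  note fin = simple_graph_finite[OF G]
  have fS: "finite S" using S fin by (auto intro: finite_subset)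
  have "(\<Sum>x\<in>V. card {e \<in> S. x \<in> e}) = (\<Sum>x\<in>V. \<Sum>e | e \<in> S \<and> x \<in> e. 1)" by simp
  also have "\<dots> = (\<Sum>e\<in>S. \<Sum>x | x \<in> V \<and> x \<in> e. 1)" by (rule sum.swap_restrict[OF fin(1) fS])
  also have "\<dots> = (\<Sum>e\<in>S. 2)"
  proof (intro sum.cong refl)
    fix e assume "e \<in> S"
    then have "e \<subseteq> V" "card e = 2" using G S by (auto simp: simple_graph_def)
    then have "{x \<in> V. x \<in> e} = e" by auto
    with \<open>card e = 2\<close> show "(\<Sum>x | x \<in> V \<and> x \<in> e. 1) = (2 :: nat)" by simp
  qed
  finally have tot: "(\<Sum>x\<in>V. card {e \<in> S. x \<in> e}) = 2 * card S" by simp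
  have cu: "{e \<in> S. u \<in> e} = S" using S by auto
  have "(\<Sum>x\<in>V - {u}. card {e \<in> S. x \<in> e}) = card S"
    using tot sum.remove[OF fin(1) u, of "\<lambda>x. card {e \<in> S. x \<in> e}"] cu by simp
  moreover have "(\<Sum>x\<in>V - {u}. card {e \<in> S. x \<in> e}) \<le> (\<Sum>x\<in>V - {u}. (card {e \<in> S. x \<in> e})\<^sup>2)"
    by (intro sum_mono) (simp add: power2_nat_le_imp_le power2_eq_square)
  ultimately show ?thesis
    using sum.remove[OF fin(1) u, of "\<lambda>x. (card {e \<in> S. x \<in> e})\<^sup>2"] cu by simp
qed

text \<open>The degree sum counts an edge once for each endpoint in \<open>U\<close>: once if it
  meets \<open>U\<close>, and once more if it lies inside \<open>U\<close>.\<close>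

lemma card_edges_meeting:
  assumes G: "simple_graph V E" and U: "U \<subseteq> V"
  shows "card {e \<in> E. e \<inter> U \<noteq> {}} + card (edges_within E U) = (\<Sum>u\<in>U. vertex_degree E u)"
proof -
  note fin = simple_graph_finite[OF G]
  have fU: "finite U" using U fin by (auto intro: finite_subset)
  have "(\<Sum>u\<in>U. vertex_degree E u) = (\<Sum>u\<in>U. \<Sum>e | e \<in> E \<and> u \<in> e. 1)"
    by (simp add: vertex_degree_def)
  also have "\<dots> = (\<Sum>e\<in>E. \<Sum>u | u \<in> U \<and> u \<in> e. 1)" by (rule sum.swap_restrict[OF fU fin(2)])
  also have "\<dots> = (\<Sum>e\<in>E. (if e \<inter> U \<noteq> {} then 1 else 0) + (if e \<subseteq> U then 1 else 0))"
  proof (intro sum.cong refl)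
    fix e assume "e \<in> E"
    then have "card e = 2" using G by (auto simp: simple_graph_def)
    then obtain a b where e: "e = {a, b}" "a \<noteq> b" by (auto simp: card_2_iff)
    have eq: "{u \<in> U. u \<in> e} = e \<inter> U" by auto
    have "card (e \<inter> U) = (if e \<inter> U \<noteq> {} then 1 else 0) + (if e \<subseteq> U then 1 else 0)"
      unfolding e(1) using e(2) by (cases "a \<in> U"; cases "b \<in> U") auto
    then show "(\<Sum>u | u \<in> U \<and> u \<in> e. 1)
        = (if e \<inter> U \<noteq> {} then 1 else 0) + (if e \<subseteq> U then 1 else (0 :: nat))"
      by (simp only: eq card_eq_sum[symmetric])
  qed
  also have "\<dots> = card {e \<in> E. e \<inter> U \<noteq> {}} + card (edges_within E U)"
    using fin by (simp add: sum.distrib edges_within_def flip: sum.inter_filter)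
  finally show ?thesis by simp
qed

text \<open>Each edge meeting \<open>U\<close> is given to its endpoint in \<open>U\<close> farthest from \<open>V - U\<close>, so the
  first edge of a shortest path from \<open>u\<close> to \<open>V - U\<close> goes to \<open>u\<close>.\<close>

lemma star_partition:
  assumes G: "simple_graph V E" and con: "connected_graph V E"
    and U: "U \<subseteq> V" "U \<noteq> V"
  obtains S where "\<And>u. u \<in> U \<Longrightarrow> S u \<subseteq> {e \<in> E. u \<in> e}" "\<And>u. u \<in> U \<Longrightarrow> S u \<noteq> {}"
    "\<And>u u'. u \<noteq> u' \<Longrightarrow> S u \<inter> S u' = {}" "(\<Union>u\<in>U. S u) = {e \<in> E. e \<inter> U \<noteq> {}}"
proof -
  define R where "R = {(x, y). {x, y} \<in> E}"
  \<comment> \<open>The distance from \<open>x\<close> to the complement of \<open>U\<close>, as the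
    least length of a walk.\<close>
  define dst where "dst x = (LEAST k. \<exists>b\<in>V - U. (x, b) \<in> R ^^ k)" for x
  obtain b where b: "b \<in> V - U" using U by auto
  have nbr: "\<exists>y. {x, y} \<in> E \<and> dst y < dst x" if x: "x \<in> U" for x
  proof -
    have "(x, b) \<in> R\<^sup>*" using con x U b by (auto simp: connected_graph_def R_def)
    then have "\<exists>k. \<exists>b\<in>V - U. (x, b) \<in> R ^^ k" using b rtrancl_imp_relpow by metis
    then have "\<exists>b\<in>V - U. (x, b) \<in> R ^^ dst x" unfolding dst_def by (rule LeastI_ex)
    then obtain b' where b': "b' \<in> V - U" "(x, b') \<in> R ^^ dst x" by blast
    \<comment> \<open>A walk of length 0 from a vertex of \<open>U\<close> ends in \<open>U\<close>,
      so the distance is positive.\<close>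
    then obtain k where k: "dst x = Suc k" using x by (cases "dst x") auto
    with b' obtain y where y: "(x, y) \<in> R" "(y, b') \<in> R ^^ k" by (metis relpow_Suc_D2)
    then have "dst y \<le> k" unfolding dst_def using b' by (intro Least_le) auto
    with y k show ?thesis by (auto simp: R_def)
  qed
  \<comment> \<open>Ties are settled by choice. As every edge has a single owner, the stars, being
    fibres of \<open>own\<close>, are disjoint.\<close>
  define own where "own e = (SOME u. u \<in> e \<inter> U \<and> (\<forall>x\<in>e \<inter> U. dst x \<le> dst u))" for e
  have own: "own e \<in> e \<inter> U \<and> (\<forall>x\<in>e \<inter> U. dst x \<le> dst (own e))" if "e \<in> E" "e \<inter> U \<noteq> {}" for e
  proof -
    have fin: "finite (e \<inter> U)" using simple_graph_finite[OF G] that by auto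
    have "Max (dst ` (e \<inter> U)) \<in> dst ` (e \<inter> U)" using fin that by (intro Max_in) auto
    then obtain u where u: "u \<in> e \<inter> U" "dst u = Max (dst ` (e \<inter> U))" by force
    have "\<forall>x\<in>e \<inter> U. dst x \<le> dst u" unfolding u(2) using fin by simp
    with u have "\<exists>u. u \<in> e \<inter> U \<and> (\<forall>x\<in>e \<inter> U. dst x \<le> dst u)" by blast
    then show ?thesis unfolding own_def by (rule someI_ex)
  qed
  show thesis
  proof (rule that[of "\<lambda>u. {e \<in> E. e \<inter> U \<noteq> {} \<and> own e = u}"])
    fix u assume u: "u \<in> U"
    show "{e \<in> E. e \<inter> U \<noteq> {} \<and> own e = u} \<subseteq> {e \<in> E. u \<in> e}" using own by blast
    obtain y where y: "{u, y} \<in> E" "dst y < dst u" using nbr[OF u] by blast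
    \<comment> \<open>The neighbour \<open>y\<close> is strictly closer, so it cannot be the owner,
      whether or not it lies in \<open>U\<close>.\<close>
    then have "own {u, y} = u" using own[of "{u, y}"] u by (auto simp: not_le[symmetric])
    with y u show "{e \<in> E. e \<inter> U \<noteq> {} \<and> own e = u} \<noteq> {}" by blast
  next
    show "(\<Union>u\<in>U. {e \<in> E. e \<inter> U \<noteq> {} \<and> own e = u}) = {e \<in> E. e \<inter> U \<noteq> {}}" using own by blast
  qed auto
qed

section \<open>Eigenvalue sums of the signless Laplacian\<close>

lemma signless_laplacian_carrier: "signless_laplacian V E \<in> carrier_mat (card V) (card V)"
  by (simp add: signless_laplacian_def degree_matrix_def adjacency_matrix_def)

lemma signless_laplacian_symmetric: "transpose_mat (signless_laplacian V E) = signless_laplacian V E"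
  by (rule eq_matI)
    (auto simp: signless_laplacian_def degree_matrix_def adjacency_matrix_def insert_commute)

text \<open>Moves the eigenbasis from matrix indices to vertices and writes the eigenvalue equation
  through incidences. From here on the enumeration of the vertices no longer appears.\<close>

lemma signless_eigenbasis:
  assumes G: "simple_graph V E"
  defines "q \<equiv> \<lambda>i. eigenvalues_desc (signless_laplacian V E) ! i"
  obtains v :: "nat \<Rightarrow> 'a \<Rightarrow> real" where
    "\<And>i j. i < card V \<Longrightarrow> j < card V \<Longrightarrow> (\<Sum>x\<in>V. v i x * v j x) = (if i = j then 1 else 0)"
    "\<And>x y. x \<in> V \<Longrightarrow> y \<in> V \<Longrightarrow> (\<Sum>i<card V. v i x * v i y) = (if x = y then 1 else 0)"
    "\<And>i x. i < card V \<Longrightarrow> x \<in> V \<Longrightarrow> (\<Sum>e | e \<in> E \<and> x \<in> e. \<Sum>y\<in>e. v i y) = q i * v i x"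
proof -
  define n where "n = card V"
  define vs where "vs = vertex_list V"
  let ?Q = "signless_laplacian V E"
  note fin = simple_graph_finite[OF G]
  have vs: "set vs = V" "distinct vs" "length vs = n"
    using vertex_list[OF fin(1)] by (simp_all add: vs_def n_def)
  have bij: "bij_betw ((!) vs) {..<n} V" using bij_betw_nth[OF vs(2)] vs by simp
  obtain w where w:
    "\<And>i j. i < n \<Longrightarrow> j < n \<Longrightarrow> (\<Sum>r<n. w i r * w j r) = (if i = j then 1 else 0)"
    "\<And>r s. r < n \<Longrightarrow> s < n \<Longrightarrow> (\<Sum>i<n. w i r * w i s) = (if r = s then 1 else 0)"
    "\<And>i r. i < n \<Longrightarrow> r < n \<Longrightarrow> (\<Sum>s<n. ?Q $$ (r, s) * w i s) = q i * w i r"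
    by (rule real_symmetric_orthonormal_eigenbasis[OF signless_laplacian_carrier[of V E]
            signless_laplacian_symmetric, folded n_def q_def]) (rule that)
  define idx where "idx = the_inv_into {..<n} ((!) vs)"
  define v where "v i x = w i (idx x)" for i x
  have idx_nth: "idx (vs ! r) = r" if "r < n" for r
    unfolding idx_def using bij that by (intro the_inv_into_f_f) (auto simp: bij_betw_def)
  have idx: "idx x < n" "vs ! idx x = x" if "x \<in> V" for x
    using that bij idx_nth unfolding bij_betw_def by auto
  have sumV: "(\<Sum>x\<in>V. g x) = (\<Sum>r<n. g (vs ! r))" for g :: "'a \<Rightarrow> real"
    using sum.reindex_bij_betw[OF bij] by metis
  show thesis
  proof (rule that[of v])
    fix i j assume "i < card V" "j < card V"
    then show "(\<Sum>x\<in>V. v i x * v j x) = (if i = j then 1 else 0)"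
      using w(1) by (simp add: sumV v_def idx_nth n_def[symmetric])
  next
    fix x y assume xy: "x \<in> V" "y \<in> V"
    then have "idx x = idx y \<longleftrightarrow> x = y" using idx(2) by metis
    then show "(\<Sum>i<card V. v i x * v i y) = (if x = y then 1 else 0)"
      using w(2)[of "idx x" "idx y"] idx(1) xy by (simp add: v_def n_def[symmetric])
  next
    fix i x assume i: "i < card V" and x: "x \<in> V"
    have Q: "?Q $$ (idx x, s) = (if s = idx x then real (vertex_degree E x) else 0)
        + (if {x, vs ! s} \<in> E then 1 else 0)" if "s < n" for s
      using that idx[OF x]
      by (simp add: signless_laplacian_def degree_matrix_def adjacency_matrix_def n_def[symmetric]
          vs_def[symmetric])
    have "q i * v i x = (\<Sum>s<n. ?Q $$ (idx x, s) * w i s)"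
      using w(3)[of i "idx x"] i idx[OF x] by (simp add: v_def n_def)
    also have "\<dots> = (\<Sum>s<n. (if s = idx x then real (vertex_degree E x) * w i s else 0)
        + (if {x, vs ! s} \<in> E then w i s else 0))"
      by (intro sum.cong refl) (simp add: Q algebra_simps)
    also have "\<dots> = real (vertex_degree E x) * v i x + (\<Sum>s<n. if {x, vs ! s} \<in> E then w i s else 0)"
      using idx[OF x] by (simp add: sum.distrib v_def)
    also have "(\<Sum>s<n. if {x, vs ! s} \<in> E then w i s else 0) = (\<Sum>y\<in>V. if {x, y} \<in> E then v i y else 0)"
      by (simp add: sumV v_def idx_nth cong: if_cong)
    finally show "(\<Sum>e | e \<in> E \<and> x \<in> e. \<Sum>y\<in>e. v i y) = q i * v i x"
      using incidence_gram_eq_signless[OF G x] by simp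
  qed
qed

text \<open>By adjointness, the inner product of the two edge vectors is that of \<open>f\<close>
  with the signless Laplacian applied to \<open>g\<close>. Orthogonal eigenvectors therefore give
  orthogonal edge vectors.\<close>

lemma incidence_eigenvectors_gram:
  assumes G: "simple_graph V E"
    and orth: "(\<Sum>x\<in>V. f x * g x) = c"
    and ev: "\<And>x. x \<in> V \<Longrightarrow> (\<Sum>e | e \<in> E \<and> x \<in> e. \<Sum>y\<in>e. g y) = q * g x"
  shows "(\<Sum>e\<in>E. (\<Sum>x\<in>e. f x) * (\<Sum>x\<in>e. g x)) = q * (c :: real)"
proof -
  have "(\<Sum>e\<in>E. (\<Sum>x\<in>e. f x) * (\<Sum>x\<in>e. g x)) = (\<Sum>x\<in>V. f x * (q * g x))"
    unfolding incidence_adjoint[OF G] by (simp add: ev)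
  then show ?thesis by (simp add: orth[symmetric] sum_distrib_left algebra_simps)
qed

text \<open>Ky Fan's principle for the Gram matrix of the incidence matrix. In the coordinates of an
  eigenbasis the left-hand side is \<open>\<Sum>i. q i * c i\<close>, and Bessel's inequality, applied once in each
  direction, gives \<open>c i \<le> 1\<close> and \<open>\<Sum>i. c i \<le> card J\<close>.\<close>

lemma ky_fan_incidence:
  fixes y :: "'j \<Rightarrow> 'a set \<Rightarrow> real"
  assumes G: "simple_graph V E" and J: "finite J" "card J \<le> card V"
    and orth: "\<And>i j. i \<in> J \<Longrightarrow> j \<in> J \<Longrightarrow> i \<noteq> j \<Longrightarrow> (\<Sum>e\<in>E. y i e * y j e) = 0"
    and norm: "\<And>j. j \<in> J \<Longrightarrow> (\<Sum>e\<in>E. (y j e)\<^sup>2) \<le> 1"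
  shows "(\<Sum>j\<in>J. \<Sum>x\<in>V. (\<Sum>e | e \<in> E \<and> x \<in> e. y j e)\<^sup>2)
    \<le> (\<Sum>i<card J. eigenvalues_desc (signless_laplacian V E) ! i)"
proof -
  define n where "n = card V"
  define q where "q i = eigenvalues_desc (signless_laplacian V E) ! i" for i
  note fin = simple_graph_finite[OF G]
  obtain v :: "nat \<Rightarrow> 'a \<Rightarrow> real" where v:
    "\<And>i j. i < n \<Longrightarrow> j < n \<Longrightarrow> (\<Sum>x\<in>V. v i x * v j x) = (if i = j then 1 else 0)"
    "\<And>x y. x \<in> V \<Longrightarrow> y \<in> V \<Longrightarrow> (\<Sum>i<n. v i x * v i y) = (if x = y then 1 else 0)"
    "\<And>i x. i < n \<Longrightarrow> x \<in> V \<Longrightarrow> (\<Sum>e | e \<in> E \<and> x \<in> e. \<Sum>y\<in>e. v i y) = q i * v i x"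
    using signless_eigenbasis[OF G] unfolding n_def q_def by blast
  \<comment> \<open>The edge vectors of the eigenbasis are pairwise orthogonal, and the squared norm
    of \<open>z i\<close> is \<open>q i\<close>; in particular the eigenvalues are
    nonnegative.\<close>
  define z where "z i e = (\<Sum>x\<in>e. v i x)" for i e
  have zz: "(\<Sum>e\<in>E. z i e * z j e) = (if i = j then q j else 0)" if "i < n" "j < n" for i j
    unfolding z_def
    using incidence_eigenvectors_gram[of V E "v i" "v j", OF G v(1)[OF that] v(3)[OF that(2)]] by simp
  have zn: "(\<Sum>e\<in>E. (z i e)\<^sup>2) = q i" if "i < n" for i
    using zz[OF that that] by (simp add: power2_eq_square)
  have q0: "0 \<le> q i" if "i < n" for i unfolding zn[OF that, symmetric] by (simp add: sum_nonneg)
  have len: "length (eigenvalues_desc (signless_laplacian V E)) = n"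
    using real_symmetric_orthonormal_eigenbasis[OF signless_laplacian_carrier signless_laplacian_symmetric]
    unfolding n_def by metis
  have qmono: "q j \<le> q i" if "i \<le> j" "j < n" for i j
    unfolding q_def using eigenvalues_desc_antimono that len by blast
  have parseval: "(\<Sum>x\<in>V. (f x)\<^sup>2) = (\<Sum>i<n. (\<Sum>x\<in>V. v i x * f x)\<^sup>2)" for f
  proof -
    have "(\<Sum>i<n. (\<Sum>x\<in>V. v i x * f x)\<^sup>2) = (\<Sum>i<n. \<Sum>x\<in>V. \<Sum>y\<in>V. f x * f y * (v i x * v i y))"
      by (simp add: power2_eq_square sum_product algebra_simps)
    also have "\<dots> = (\<Sum>x\<in>V. \<Sum>y\<in>V. \<Sum>i<n. f x * f y * (v i x * v i y))"
      by (subst sum.swap, intro sum.cong refl, rule sum.swap)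
    also have "\<dots> = (\<Sum>x\<in>V. \<Sum>y\<in>V. if x = y then (f x)\<^sup>2 else 0)"
      by (intro sum.cong refl) (auto simp: v(2) power2_eq_square simp flip: sum_distrib_left)
    finally show ?thesis using fin by simp
  qed
  define a where "a i j = (\<Sum>e\<in>E. z i e * y j e)\<^sup>2" for i j
  \<comment> \<open>By adjointness, the coefficient at \<open>v i\<close> of the vertex vector
    obtained from \<open>y j\<close> is the inner product of \<open>z i\<close> and
    \<open>y j\<close>.\<close>
  have total: "(\<Sum>x\<in>V. (\<Sum>e | e \<in> E \<and> x \<in> e. y j e)\<^sup>2) = (\<Sum>i<n. a i j)" for j
    unfolding parseval a_def z_def incidence_adjoint[OF G] ..
  \<comment> \<open>If \<open>q i = 0\<close>, then \<open>c i = 0\<close> by the convention for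
    division by zero; \<open>aq\<close> then makes the sum of the \<open>a i j\<close> vanish too,
    so \<open>qc\<close> holds in this case as well.\<close>
  define c where "c i = (\<Sum>j\<in>J. a i j / q i)" for i
  have c0: "0 \<le> c i" if "i < n" for i
    unfolding c_def a_def using q0[OF that] by (intro sum_nonneg) simp
  have aq: "(\<Sum>j\<in>J. a i j) \<le> q i" if "i < n" for i
  proof -
    \<comment> \<open>First use of Bessel: the family is \<open>y\<close> and the test vector is
      \<open>z i\<close>. Dividing by a squared norm of at most 1 only enlarges a term, and a zero
      vector \<open>y j\<close> gives \<open>a i j = 0\<close>.\<close>
    have "(\<Sum>j\<in>J. a i j) \<le> (\<Sum>j\<in>J. (\<Sum>e\<in>E. y j e * z i e)\<^sup>2 / (\<Sum>e\<in>E. (y j e)\<^sup>2))"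
    proof (rule sum_mono)
      fix j assume j: "j \<in> J"
      have eq: "a i j = (\<Sum>e\<in>E. y j e * z i e)\<^sup>2" by (simp add: a_def mult.commute)
      show "a i j \<le> (\<Sum>e\<in>E. y j e * z i e)\<^sup>2 / (\<Sum>e\<in>E. (y j e)\<^sup>2)"
      proof (cases "(\<Sum>e\<in>E. (y j e)\<^sup>2) = 0")
        case True
        then have "\<forall>e\<in>E. y j e = 0" using fin by (simp add: sum_nonneg_eq_0_iff)
        then show ?thesis by (simp add: a_def)
      next
        case False
        then have "0 < (\<Sum>e\<in>E. (y j e)\<^sup>2)" by (simp add: less_le sum_nonneg)
        then show ?thesis unfolding eq using norm[OF j]
          by (simp add: le_divide_eq mult_left_le)
      qed
    qed
    also have "\<dots> \<le> (\<Sum>e\<in>E. (z i e)\<^sup>2)" by (rule bessel_inequality[OF J(1) orth])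
    finally show ?thesis using zn[OF that] by simp
  qed
  have c1: "c i \<le> 1" if "i < n" for i
    using aq[OF that] q0[OF that]
    by (cases "q i = 0") (simp_all add: c_def divide_le_eq flip: sum_divide_distrib)
  have qc: "q i * c i = (\<Sum>j\<in>J. a i j)" if "i < n" for i
  proof (cases "q i = 0")
    case True
    then have "(\<Sum>j\<in>J. a i j) = 0"
      using aq[OF that] by (intro antisym sum_nonneg) (auto simp: a_def)
    with True show ?thesis by simp
  qed (simp add: c_def flip: sum_divide_distrib)
  have "(\<Sum>i<n. c i) = (\<Sum>j\<in>J. \<Sum>i<n. a i j / q i)"
    unfolding c_def by (rule sum.swap)
  also have "\<dots> \<le> (\<Sum>j\<in>J. 1)"
  proof (rule sum_mono)
    fix j assume j: "j \<in> J"
    have "(\<Sum>i<n. a i j / q i) = (\<Sum>i<n. (\<Sum>e\<in>E. z i e * y j e)\<^sup>2 / (\<Sum>e\<in>E. (z i e)\<^sup>2))"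
      by (simp add: a_def zn)
    \<comment> \<open>Second use of Bessel, with the roles exchanged: the family is \<open>z\<close>
      and the test vector is \<open>y j\<close>.\<close>
    also have "\<dots> \<le> (\<Sum>e\<in>E. (y j e)\<^sup>2)"
      by (rule bessel_inequality) (simp_all add: zz)
    finally show "(\<Sum>i<n. a i j / q i) \<le> 1" using norm[OF j] by simp
  qed
  finally have cs: "(\<Sum>i<n. c i) \<le> real (card J)" by simp
  have "(\<Sum>j\<in>J. \<Sum>x\<in>V. (\<Sum>e | e \<in> E \<and> x \<in> e. y j e)\<^sup>2) = (\<Sum>i<n. \<Sum>j\<in>J. a i j)"
    unfolding total by (rule sum.swap)
  also have "\<dots> = (\<Sum>i<n. q i * c i)" by (simp add: qc)
  also have "\<dots> \<le> (\<Sum>i<card J. q i)"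
    by (rule sum_weighted_le_sum_initial[OF qmono q0 c0 c1 cs]) (use J n_def in simp_all)
  finally show ?thesis by (simp add: q_def)
qed

text \<open>The witness is the edge vector of a top unit eigenvector, divided by the square root of
  the eigenvalue \<open>q\<close>. Its norm is 1 if \<open>q > 0\<close>; if \<open>q = 0\<close>,
  division by zero turns it into the zero vector, which is why the bound is an inequality.\<close>

lemma top_eigenvalue_edge_vector:
  assumes G: "simple_graph V E" and V: "V \<noteq> {}"
  obtains y :: "'a set \<Rightarrow> real" where "(\<Sum>e\<in>E. (y e)\<^sup>2) \<le> 1"
    "(\<Sum>x\<in>V. (\<Sum>e | e \<in> E \<and> x \<in> e. y e)\<^sup>2) = signless_eigenvalue V E 1"
proof -
  define q where "q = signless_eigenvalue V E 1"
  have pos: "0 < card V" using simple_graph_finite[OF G] V by (simp add: card_gt_0_iff)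
  obtain v :: "nat \<Rightarrow> 'a \<Rightarrow> real" where v:
    "(\<Sum>x\<in>V. v 0 x * v 0 x) = 1"
    "\<And>x. x \<in> V \<Longrightarrow> (\<Sum>e | e \<in> E \<and> x \<in> e. \<Sum>y\<in>e. v 0 y) = q * v 0 x"
    using signless_eigenbasis[OF G] pos unfolding q_def signless_eigenvalue_def
    by (metis diff_self_eq_0)
  have zz: "(\<Sum>e\<in>E. (\<Sum>x\<in>e. v 0 x)\<^sup>2) = q"
    using incidence_eigenvectors_gram[of V E "v 0" "v 0", OF G v] by (simp add: power2_eq_square)
  then have q: "0 \<le> q" by (metis sum_nonneg zero_le_power2)
  show thesis
  proof (rule that[of "\<lambda>e. (\<Sum>x\<in>e. v 0 x) / sqrt q"])
    show "(\<Sum>e\<in>E. ((\<Sum>x\<in>e. v 0 x) / sqrt q)\<^sup>2) \<le> 1"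
      using q by (simp add: power_divide zz flip: sum_divide_distrib)
    have "(\<Sum>x\<in>V. (\<Sum>e | e \<in> E \<and> x \<in> e. (\<Sum>x\<in>e. v 0 x) / sqrt q)\<^sup>2)
        = (\<Sum>x\<in>V. q * (v 0 x * v 0 x))"
      using q by (intro sum.cong refl)
        (auto simp: v(2) power_divide power2_eq_square simp flip: sum_divide_distrib)
    also have "\<dots> = q" by (simp add: v(1) flip: sum_distrib_left)
    finally show "(\<Sum>x\<in>V. (\<Sum>e | e \<in> E \<and> x \<in> e. (\<Sum>x\<in>e. v 0 x) / sqrt q)\<^sup>2)
        = signless_eigenvalue V E 1" by (simp add: q_def)
  qed
qed

theorem theorem4p7:
  fixes V :: "'a set" and E :: "'a set set" and U :: "'a set" and n m :: nat
  assumes "simple_graph V E"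
    and "connected_graph V E"
    and "n = card V" and "n \<ge> 3"
    and "U \<subseteq> V" and "m = card U" and "m < n"
  shows "(\<Sum>i=1..m+1. signless_eigenvalue V E i)
    \<ge> (\<Sum>u\<in>U. real (vertex_degree E u)) + real m - real (card (edges_within E U))
      + signless_eigenvalue (V - U) (edges_within E (V - U)) 1"
proof -
  let ?F = "edges_within E (V - U)"
  note G = assms(1)
  note fin = simple_graph_finite[OF G]
  have fU: "finite U" using assms(5) fin by (auto intro: finite_subset)
  have "U \<noteq> V" using assms by auto
  obtain S where S: "\<And>u. u \<in> U \<Longrightarrow> S u \<subseteq> {e \<in> E. u \<in> e}" "\<And>u. u \<in> U \<Longrightarrow> S u \<noteq> {}"
    "\<And>u u'. u \<noteq> u' \<Longrightarrow> S u \<inter> S u' = {}" "(\<Union>u\<in>U. S u) = {e \<in> E. e \<inter> U \<noteq> {}}"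
    by (rule star_partition[OF G assms(2,5) \<open>U \<noteq> V\<close>]) (rule that)
  have GF: "simple_graph (V - U) ?F" by (rule simple_graph_edges_within[OF G]) simp
  obtain y where y: "(\<Sum>e\<in>?F. (y e)\<^sup>2) \<le> 1"
    "(\<Sum>x\<in>V - U. (\<Sum>e | e \<in> ?F \<and> x \<in> e. y e)\<^sup>2) = signless_eigenvalue (V - U) ?F 1"
    using top_eigenvalue_edge_vector[OF GF] \<open>U \<noteq> V\<close> assms(5) by blast
  have SE: "S u \<subseteq> E" if "u \<in> U" for u using S(1)[OF that] by auto
  have fS: "finite (S u)" if "u \<in> U" for u using SE[OF that] fin by (auto intro: finite_subset)
  have FE: "?F \<subseteq> E" by (auto simp: edges_within_def)
  have SF: "S u \<inter> ?F = {}" if "u \<in> U" for u using S(1)[OF that] that by (auto simp: edges_within_def)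
  \<comment> \<open>\<open>None\<close> indexes the vector of the subgraph induced on
    \<open>V - U\<close>, extended by zero, and \<open>Some u\<close> the normalised star at
    \<open>u\<close>.\<close>
  define J where "J = insert None (Some ` U)"
  define Y where "Y j e = (case j of None \<Rightarrow> if e \<in> ?F then y e else 0
      | Some u \<Rightarrow> if e \<in> S u then 1 / sqrt (card (S u)) else 0)" for j e
  have J: "finite J" "card J = m + 1"
    using fU assms(6) by (auto simp: J_def card_image)
  \<comment> \<open>The sum over \<open>V - U\<close> is the top eigenvalue of the induced subgraph;
    the squares at vertices of \<open>U\<close> can only add to it.\<close>
  have None: "(\<Sum>x\<in>V. (\<Sum>e | e \<in> E \<and> x \<in> e. Y None e)\<^sup>2) \<ge> signless_eigenvalue (V - U) ?F 1"
  proof -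
    have "(\<Sum>e | e \<in> E \<and> x \<in> e. Y None e) = (\<Sum>e | e \<in> ?F \<and> x \<in> e. y e)" for x
      using FE fin by (intro sum.mono_neutral_cong_right) (auto simp: Y_def)
    then show ?thesis unfolding y(2)[symmetric]
      by simp (rule sum_mono2, use fin in auto)
  qed
  \<comment> \<open>With \<open>s = card (S u)\<close>, the star bound \<open>s^2 + s\<close> is
    divided by the squared normalising factor \<open>s\<close>. Nonemptiness of the star is what
    secures the extra 1.\<close>
  have Some: "(\<Sum>x\<in>V. (\<Sum>e | e \<in> E \<and> x \<in> e. Y (Some u) e)\<^sup>2) \<ge> real (card (S u)) + 1" if u: "u \<in> U" for u
  proof -
    have pos: "0 < card (S u)" using S(2)[OF u] fS[OF u] by (simp add: card_gt_0_iff)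
    have "(\<Sum>e | e \<in> E \<and> x \<in> e. Y (Some u) e) = (\<Sum>e | e \<in> S u \<and> x \<in> e. 1 / sqrt (card (S u)))" for x
      using SE[OF u] fin by (intro sum.mono_neutral_cong_right) (auto simp: Y_def)
    then have "(\<Sum>x\<in>V. (\<Sum>e | e \<in> E \<and> x \<in> e. Y (Some u) e)\<^sup>2)
        = (\<Sum>x\<in>V. real ((card {e \<in> S u. x \<in> e})\<^sup>2)) / card (S u)"
      by (simp add: power_divide sum_divide_distrib)
    also have "\<dots> \<ge> real ((card (S u))\<^sup>2 + card (S u)) / card (S u)"
      using star_incidence[OF G _ S(1)[OF u]] u assms(5)
      by (intro divide_right_mono) (auto simp only: of_nat_sum[symmetric] of_nat_le_iff of_nat_0_le_iff subset_iff)
    finally show ?thesis using pos by (simp add: power2_eq_square add_divide_distrib)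
  qed
  have orth: "(\<Sum>e\<in>E. Y i e * Y j e) = 0" if "i \<in> J" "j \<in> J" "i \<noteq> j" for i j
  proof (intro sum.neutral ballI)
    fix e
    have "e \<notin> S u" if "u \<in> U" "e \<in> ?F" for u using SF that by blast
    moreover have "e \<notin> S u" if "u \<noteq> u'" "e \<in> S u'" for u u' using S(3) that by blast
    ultimately show "Y i e * Y j e = 0"
      using that by (cases i; cases j) (auto simp: J_def Y_def)
  qed
  have norm: "(\<Sum>e\<in>E. (Y j e)\<^sup>2) \<le> 1" if "j \<in> J" for j
  proof (cases j)
    case None
    then have "(\<Sum>e\<in>E. (Y j e)\<^sup>2) = (\<Sum>e\<in>?F. (y e)\<^sup>2)"
      using FE fin by (intro sum.mono_neutral_cong_right) (auto simp: Y_def)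
    with y show ?thesis by simp
  next
    case (Some u)
    with that have "u \<in> U" by (auto simp: J_def)
    then have "(\<Sum>e\<in>E. (Y j e)\<^sup>2) = (\<Sum>e\<in>S u. 1 / card (S u))"
      using SE fin Some by (intro sum.mono_neutral_cong_right) (auto simp: Y_def power_divide)
    then show ?thesis by simp
  qed
  have "(\<Sum>u\<in>U. card (S u)) = card (\<Union>u\<in>U. S u)"
    using fU fS S(3) by (intro card_UN_disjoint[symmetric]) auto
  then have "real (\<Sum>u\<in>U. card (S u)) + real (card (edges_within E U)) = (\<Sum>u\<in>U. real (vertex_degree E u))"
    unfolding S(4) using card_edges_meeting[OF G assms(5)]
    by (metis of_nat_add of_nat_sum)
  then have "(\<Sum>u\<in>U. real (vertex_degree E u)) + real m - real (card (edges_within E U))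
      + signless_eigenvalue (V - U) ?F 1
      = signless_eigenvalue (V - U) ?F 1 + (\<Sum>u\<in>U. real (card (S u)) + 1)"
    using assms(6) by (simp add: sum.distrib)
  also have "\<dots> \<le> (\<Sum>x\<in>V. (\<Sum>e | e \<in> E \<and> x \<in> e. Y None e)\<^sup>2)
      + (\<Sum>u\<in>U. \<Sum>x\<in>V. (\<Sum>e | e \<in> E \<and> x \<in> e. Y (Some u) e)\<^sup>2)"
    by (intro add_mono sum_mono None Some)
  also have "\<dots> = (\<Sum>j\<in>J. \<Sum>x\<in>V. (\<Sum>e | e \<in> E \<and> x \<in> e. Y j e)\<^sup>2)"
    unfolding J_def using fU by (simp add: sum.reindex image_iff)
  also have "\<dots> \<le> (\<Sum>i<m + 1. eigenvalues_desc (signless_laplacian V E) ! i)"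
  proof -
    \<comment> \<open>There are \<open>m + 1\<close> vectors, and \<open>m < n\<close> leaves room
      for exactly that many eigenvalues.\<close>
    have "card J \<le> card V" using J(2) assms(3,7) by simp
    show ?thesis unfolding J(2)[symmetric]
      by (rule ky_fan_incidence[OF G J(1) \<open>card J \<le> card V\<close> orth norm])
  qed
  \<comment> \<open>List positions start at 0, the numbering of the eigenvalues at 1.\<close>
  also have "\<dots> = (\<Sum>i=1..m+1. signless_eigenvalue V E i)"
    by (rule sum.reindex_bij_witness[of _ "\<lambda>i. i - 1" Suc]) (auto simp: signless_eigenvalue_def)
  finally show ?thesis .
qed

end
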